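(* Let $0<\alpha\le1$, $T>0$, $N\in\mathbb{N}$, $\tau=T/N$, $t_n=n\tau$, let $f$ be a function on $[0,T]$, and let $f_n:=f(t_n)$ for $n=0,1,\dots,N$. Then $$f_n=f_0+\frac{\tau^\alpha}{\Gamma_\alpha}\sum_{k=1}^n(n-k+1)^{\alpha-1}(D^\alpha_\tau f)_k,\qquad 1\le n\le N,$$ and $$f_n=f_N-\frac{\tau^\alpha}{\Gamma_\alpha}\sum_{k=n}^{N-1}(k-n+1)^{\alpha-1}({}^*D^\alpha_\tau f)_k,\qquad 0\le n\le N-1.$$
   Context: $\Gamma_\alpha$ is the Gamma function at $\alpha$. Functions may be real-valued or take values in a real Banach space. The sequence $\{\lambda_k\}_{k\ge1}$ is defined by $\lambda_1=1$ and $\lambda_{k+1}=\sum_{j=1}^k\big((k-j+1)^{\alpha-1}-(k-j+2)^{\alpha-1}\big)\lambda_j$ for $k\ge1$. The left and right discrete Caputo derivatives are $$(D^\alpha_\tau f)_k=\Gamma_\alpha\tau^{-\alpha}\sum_{j=0}^{k-1}\lambda_{k-j}(f_{j+1}-f_j),\quad 1\le k\le N,$$ $$({}^*D^\alpha_\tau f)_k=\Gamma_\alpha\tau^{-\alpha}\sum_{j=k+1}^{N}\lambda_{j-k}(f_j-f_{j-1}),\quad 0\le k\le N-1.$$ *)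

theory Defs
  imports "HOL-Analysis.Analysis"
begin

text \<open>The sequence starts at index 1; the value at index 0 is a dummy that is never used.\<close>

function caputo_lambda :: "real \<Rightarrow> nat \<Rightarrow> real" where
  "caputo_lambda \<alpha> 0 = 0"
| "caputo_lambda \<alpha> (Suc 0) = 1"
| "k \<ge> 1 \<Longrightarrow> caputo_lambda \<alpha> (Suc k) =
     (\<Sum>j=1..k. (real (k - j + 1) powr (\<alpha> - 1) - real (k - j + 2) powr (\<alpha> - 1)) * caputo_lambda \<alpha> j)"
  by (auto, metis One_nat_def Suc_leI not0_implies_Suc zero_less_Suc)
termination
  by (relation "Wellfounded.measure snd") auto

text \<open>Both operators act on grid functions \<open>u\<close>, of which only the values \<open>u 0, \<dots>, u N\<close> matter;
  the left derivative is meant for \<open>1 \<le> k \<le> N\<close>, the right one for \<open>0 \<le> k \<le> N - 1\<close>.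
  The left derivative at \<open>k\<close> does not involve \<open>N\<close>.\<close>

definition left_caputo :: "real \<Rightarrow> real \<Rightarrow> (nat \<Rightarrow> 'a::banach) \<Rightarrow> nat \<Rightarrow> 'a" where
  "left_caputo \<alpha> \<tau> u k =
     (Gamma \<alpha> * \<tau> powr (- \<alpha>)) *\<^sub>R
       (\<Sum>j=0..<k. caputo_lambda \<alpha> (k - j) *\<^sub>R (u (j + 1) - u j))"

definition right_caputo :: "real \<Rightarrow> real \<Rightarrow> nat \<Rightarrow> (nat \<Rightarrow> 'a::banach) \<Rightarrow> nat \<Rightarrow> 'a" where
  "right_caputo \<alpha> \<tau> N u k =
     (Gamma \<alpha> * \<tau> powr (- \<alpha>)) *\<^sub>R
       (\<Sum>j=k+1..N. caputo_lambda \<alpha> (j - k) *\<^sub>R (u j - u (j - 1)))"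

end

theory Submission
  imports Defs
begin

text \<open>
  Write \<open>w m = m powr (\<alpha> - 1)\<close> for the weights.  The recursion for the coefficients \<open>caputo_lambda\<close>
  says exactly that the discrete convolution \<open>w m * \<lambda> 1 + \<dots> + w 1 * \<lambda> m\<close> has the same value
  for all \<open>m \<ge> 1\<close>, and this value is \<open>\<lambda> 1 = 1\<close> (lemma \<open>caputo_lambda_convolution\<close>).
  The left Caputo derivative is, up to the factor \<open>\<Gamma>(\<alpha>) \<tau>\<^sup>-\<^sup>\<alpha>\<close>, the convolution of the
  coefficients with the forward differences of \<open>u\<close>.  Convolving it with \<open>w\<close> therefore
  convolves the differences with the constant sequence 1, that is, it sums them up, and the
  sum telescopes to \<open>u n - u 0\<close>.

  The right derivative needs no second computation: reflecting the grid by \<open>j \<mapsto> N - j\<close> turns it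
  into the negative of a left derivative, since the reflection reverses the sign of differences.
\<close>

text \<open>Passing from \<open>k\<close> to \<open>k + 1\<close>, the terms of the sum that are already present change by exactly
  the amount that the recursion assigns, with opposite sign, to the new coefficient.\<close>

lemma caputo_lambda_convolution:
  assumes "1 \<le> m"
  shows "(\<Sum>j=1..m. real (m - j + 1) powr (\<alpha> - 1) * caputo_lambda \<alpha> j) = 1"
  using assms
proof (induction m rule: dec_induct)
  case base
  show ?case by simp
next
  case (step k)
  have "(\<Sum>j=1..Suc k. real (Suc k - j + 1) powr (\<alpha> - 1) * caputo_lambda \<alpha> j)
      = (\<Sum>j=1..k. real (Suc k - j + 1) powr (\<alpha> - 1) * caputo_lambda \<alpha> j) + caputo_lambda \<alpha> (Suc k)"
    by simp
  also have "(\<Sum>j=1..k. real (Suc k - j + 1) powr (\<alpha> - 1) * caputo_lambda \<alpha> j)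
      = (\<Sum>j=1..k. real (k - j + 2) powr (\<alpha> - 1) * caputo_lambda \<alpha> j)"
    by (intro sum.cong) (auto simp: Suc_diff_le)
  also have "caputo_lambda \<alpha> (Suc k)
      = (\<Sum>j=1..k. real (k - j + 1) powr (\<alpha> - 1) * caputo_lambda \<alpha> j)
        - (\<Sum>j=1..k. real (k - j + 2) powr (\<alpha> - 1) * caputo_lambda \<alpha> j)"
    by (simp only: caputo_lambda.simps(3)[OF \<open>1 \<le> k\<close>] left_diff_distrib sum_subtractf)
  finally show ?case using step.IH by simp
qed

text \<open>Interchanging the summations leaves, in front of the difference at \<open>j\<close>, a translate by \<open>j\<close>
  of the convolution that is identically 1.\<close>

lemma sum_weighted_caputo_lambda_differences:
  fixes u :: "nat \<Rightarrow> 'a::real_vector"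
  shows "(\<Sum>k=1..n. real (n - k + 1) powr (\<alpha> - 1) *\<^sub>R
           (\<Sum>j=0..<k. caputo_lambda \<alpha> (k - j) *\<^sub>R (u (j + 1) - u j))) = u n - u 0"
proof -
  let ?a = "\<lambda>k j. (real (n - k + 1) powr (\<alpha> - 1) * caputo_lambda \<alpha> (k - j)) *\<^sub>R (u (j + 1) - u j)"
  have inner: "(\<Sum>k=Suc j..n. real (n - k + 1) powr (\<alpha> - 1) * caputo_lambda \<alpha> (k - j)) = 1"
    if "j < n" for j
  proof -
    have "(\<Sum>k=Suc j..n. real (n - k + 1) powr (\<alpha> - 1) * caputo_lambda \<alpha> (k - j))
        = (\<Sum>i=1..n - j. real (n - j - i + 1) powr (\<alpha> - 1) * caputo_lambda \<alpha> i)"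
      by (rule sum.reindex_bij_witness[of _ "\<lambda>i. i + j" "\<lambda>k. k - j"]) (use that in auto)
    also have "\<dots> = 1" using that by (intro caputo_lambda_convolution) simp
    finally show ?thesis .
  qed
  have "(\<Sum>k=1..n. real (n - k + 1) powr (\<alpha> - 1) *\<^sub>R
           (\<Sum>j=0..<k. caputo_lambda \<alpha> (k - j) *\<^sub>R (u (j + 1) - u j)))
      = (\<Sum>k=1..n. \<Sum>j<k. ?a k j)"
    by (simp add: scaleR_sum_right atLeast0LessThan)
  (* The inner sum is empty for k = 0. *)
  also have "\<dots> = (\<Sum>k\<le>n. \<Sum>j<k. ?a k j)"
    by (intro sum.mono_neutral_left) (auto simp: not_less_eq_eq)
  also have "\<dots> = (\<Sum>j<n. \<Sum>k=Suc j..n. ?a k j)"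
    by (rule sum.nested_swap')
  also have "\<dots> = (\<Sum>j<n. u (Suc j) - u j)"
    by (intro sum.cong refl) (simp only: scaleR_sum_left[symmetric] inner lessThan_iff, simp)
  also have "\<dots> = u n - u 0"
    by (rule sum_lessThan_telescope)
  finally show ?thesis .
qed

lemma left_caputo_inversion:
  fixes u :: "nat \<Rightarrow> 'a::banach"
  assumes "0 < \<alpha>" and "0 < \<tau>"
  shows "u n = u 0 + (\<tau> powr \<alpha> / Gamma \<alpha>) *\<^sub>R
           (\<Sum>k=1..n. real (n - k + 1) powr (\<alpha> - 1) *\<^sub>R left_caputo \<alpha> \<tau> u k)"
proof -
  let ?c = "Gamma \<alpha> * \<tau> powr (- \<alpha>)"
  have "(\<tau> powr \<alpha> / Gamma \<alpha>) * ?c = 1"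
    using \<open>0 < \<tau>\<close> less_imp_neq[OF Gamma_real_pos[OF \<open>0 < \<alpha>\<close>]] by (simp add: powr_minus)
  moreover have "(\<Sum>k=1..n. real (n - k + 1) powr (\<alpha> - 1) *\<^sub>R left_caputo \<alpha> \<tau> u k)
      = ?c *\<^sub>R (\<Sum>k=1..n. real (n - k + 1) powr (\<alpha> - 1) *\<^sub>R
           (\<Sum>j=0..<k. caputo_lambda \<alpha> (k - j) *\<^sub>R (u (j + 1) - u j)))"
    unfolding left_caputo_def
    by (subst scaleR_sum_right) (intro sum.cong refl scaleR_left_commute)
  ultimately show ?thesis
    by (simp only: sum_weighted_caputo_lambda_differences scaleR_scaleR scaleR_one) simp
qed

lemma right_caputo_reflect:
  fixes u :: "nat \<Rightarrow> 'a::banach"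
  assumes "k \<le> N"
  shows "right_caputo \<alpha> \<tau> N u k = - left_caputo \<alpha> \<tau> (\<lambda>j. u (N - j)) (N - k)"
proof -
  have "(\<Sum>j=k+1..N. caputo_lambda \<alpha> (j - k) *\<^sub>R (u j - u (j - 1)))
      = (\<Sum>i=0..<N - k. caputo_lambda \<alpha> (N - k - i) *\<^sub>R (u (N - i) - u (N - (i + 1))))"
    by (rule sum.reindex_bij_witness[of _ "\<lambda>i. N - i" "\<lambda>j. N - j"]) auto
  also have "\<dots> = - (\<Sum>i=0..<N - k. caputo_lambda \<alpha> (N - k - i) *\<^sub>R (u (N - (i + 1)) - u (N - i)))"
    by (simp only: sum_negf[symmetric] scaleR_minus_right[symmetric] minus_diff_eq)
  finally show ?thesis
    unfolding right_caputo_def left_caputo_def by (simp only: scaleR_minus_right)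
qed

lemma right_caputo_inversion:
  fixes u :: "nat \<Rightarrow> 'a::banach"
  assumes "0 < \<alpha>" and "0 < \<tau>" and "n < N"
  shows "u n = u N - (\<tau> powr \<alpha> / Gamma \<alpha>) *\<^sub>R
           (\<Sum>k=n..N-1. real (k - n + 1) powr (\<alpha> - 1) *\<^sub>R right_caputo \<alpha> \<tau> N u k)"
proof -
  let ?v = "\<lambda>j. u (N - j)"
  have "(\<Sum>k=n..N-1. real (k - n + 1) powr (\<alpha> - 1) *\<^sub>R right_caputo \<alpha> \<tau> N u k)
      = (\<Sum>i=1..N - n. real (N - n - i + 1) powr (\<alpha> - 1) *\<^sub>R - left_caputo \<alpha> \<tau> ?v i)"
    by (rule sum.reindex_bij_witness[of _ "\<lambda>i. N - i" "\<lambda>k. N - k"])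
      (use \<open>n < N\<close> in \<open>auto simp: right_caputo_reflect\<close>)
  also have "\<dots> = - (\<Sum>i=1..N - n. real (N - n - i + 1) powr (\<alpha> - 1) *\<^sub>R left_caputo \<alpha> \<tau> ?v i)"
    by (simp only: scaleR_minus_right sum_negf)
  finally show ?thesis
    using left_caputo_inversion[OF assms(1,2), of ?v "N - n"] \<open>n < N\<close> by simp
qed

theorem proposition2:
  fixes \<alpha> T \<tau> :: real and N :: nat and t :: "nat \<Rightarrow> real"
    and f :: "real \<Rightarrow> 'a::banach" and u :: "nat \<Rightarrow> 'a"
  assumes "0 < \<alpha>" and "\<alpha> \<le> 1" and "0 < T" and "1 \<le> N"
    and "\<tau> = T / real N"
    and "\<And>n. t n = real n * \<tau>"
    and "\<And>n. n \<le> N \<Longrightarrow> u n = f (t n)"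
  shows "(\<forall>n. 1 \<le> n \<and> n \<le> N \<longrightarrow>
            u n = u 0 + (\<tau> powr \<alpha> / Gamma \<alpha>) *\<^sub>R
              (\<Sum>k=1..n. real (n - k + 1) powr (\<alpha> - 1) *\<^sub>R left_caputo \<alpha> \<tau> u k))
       \<and> (\<forall>n. n \<le> N - 1 \<longrightarrow>
            u n = u N - (\<tau> powr \<alpha> / Gamma \<alpha>) *\<^sub>R
              (\<Sum>k=n..N-1. real (k - n + 1) powr (\<alpha> - 1) *\<^sub>R right_caputo \<alpha> \<tau> N u k))"
proof -
  have "0 < \<tau>" using assms(3-5) by simp
  moreover have "n < N" if "n \<le> N - 1" for n
    using that \<open>1 \<le> N\<close> by linarith
  ultimately show ?thesis
    by (intro conjI allI impI left_caputo_inversion right_caputo_inversion assms(1))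
qed

end
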